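(* For $\lambda\in\mathbb{R}$, with $u$ a formal variable, $$e^{(1\otimes1)u}=\sum_{n=0}^{\infty}\sum_{k=0}^{n}k!\,S(n,k)\,\lambda^{n-k}u^n\,\mathbf{1}_k/n!=\sum_{n=0}^{\infty}\sum_{k=0}^{\infty}n!\,S(n+k,n)\,\lambda^{k}u^{n+k}\,\mathbf{1}_n/(n+k)!,$$ where $S(n,k)$ are the Stirling numbers of the second kind.
   Context: For $\lambda\in\mathbb{R}$, $\widehat{\mathrm{Sh}}_\lambda(\mathbb{R})=\prod_{k\ge 0}\mathbb{R}\,\mathbf{1}_k$ is the commutative $\mathbb{R}$-algebra of all formal infinite sums $\sum_{k\ge 0}a_k\mathbf{1}_k$ ($\mathbf{1}_k$ stands for $1\otimes\cdots\otimes1$ with $k+1$ factors, so $1\otimes 1=\mathbf{1}_1$). Its product is given on basis elements by $$\mathbf{1}_m\mathbf{1}_n=\sum_{i=0}^{\min(m,n)}\lambda^i\binom{m+n-i}{m}\binom{m}{i}\mathbf{1}_{m+n-i}$$ and extended to infinite sums by distributivity. The unit is $\mathbf{1}_0=1$. The identity is between formal power series in $u$ with coefficients in $\widehat{\mathrm{Sh}}_\lambda(\mathbb{R})$, where $e^{(1\otimes1)u}=\sum_{n\ge0}(1\otimes1)^nu^n/n!$; sums are formal (compared coefficientwise in $u^a\mathbf{1}_b$). $\lambda^0=1$ (also for $\lambda=0$). $S(n,k)$ is the number of set partitions of an $n$-element set into $k$ nonempty blocks, $S(0,0)=1$. *)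

theory Defs
  imports
    "HOL-Algebra.Module"
    "HOL-Computational_Algebra.Formal_Power_Series"
    "HOL-Combinatorics.Stirling"
    "HOL-Library.Disjoint_Sets"
begin

section \<open>The algebra of formal infinite sums\<close>

text \<open>
  The formal sum \<open>\<Sum>k. a\<^sub>k 1\<^sub>k\<close> is represented by its coefficient function \<open>a :: nat \<Rightarrow> real\<close>;
  \<open>sh_basis k\<close> is \<open>1\<^sub>k\<close>, the tensor \<open>1 \<otimes> \<dots> \<otimes> 1\<close> with \<open>k + 1\<close> factors.
\<close>

definition sh_basis :: "nat \<Rightarrow> nat \<Rightarrow> real" where
  "sh_basis k = (\<lambda>c. if c = k then 1 else 0)"

definition sh_basis_mult :: "real \<Rightarrow> nat \<Rightarrow> nat \<Rightarrow> nat \<Rightarrow> real" where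
  "sh_basis_mult lam m n = (\<lambda>c. \<Sum>i = 0..min m n.
     lam ^ i * real ((m + n - i) choose m) * real (m choose i) * sh_basis (m + n - i) c)"

text \<open>
  Only the products \<open>1\<^sub>m 1\<^sub>n\<close> with \<open>m, n \<le> c\<close> have a nonzero coefficient at \<open>1\<^sub>c\<close>
  (lemma \<open>sh_basis_mult_eq_0\<close>), so the extension by distributivity to infinite sums is
  a finite sum in each coefficient.
\<close>

definition Sh :: "real \<Rightarrow> (real, nat \<Rightarrow> real) module" where
  "Sh lam =
    \<lparr>carrier = UNIV,
     monoid.mult = (\<lambda>a b c. \<Sum>m\<le>c. \<Sum>n\<le>c. a m * b n * sh_basis_mult lam m n c),
     one = sh_basis 0,
     zero = (\<lambda>c. 0),
     add = (\<lambda>a b c. a c + b c),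
     smult = (\<lambda>r a c. r * a c)\<rparr>"

lemma sh_basis_mult_eq_0: "\<not> (m \<le> c \<and> n \<le> c) \<Longrightarrow> sh_basis_mult lam m n c = 0"
  unfolding sh_basis_mult_def sh_basis_def by (rule sum.neutral) auto

lemma Sh_mult_basis: "sh_basis m \<otimes>\<^bsub>Sh lam\<^esub> sh_basis n = sh_basis_mult lam m n"
proof
  fix c
  have "(sh_basis m \<otimes>\<^bsub>Sh lam\<^esub> sh_basis n) c =
      (\<Sum>m'\<le>c. \<Sum>n'\<le>c. if m' = m then (if n' = n then sh_basis_mult lam m n c else 0) else 0)"
    unfolding Sh_def by (auto simp: sh_basis_def intro!: sum.cong)
  also have "\<dots> = (\<Sum>m'\<le>c. if m' = m then
      (\<Sum>n'\<le>c. if n' = n then sh_basis_mult lam m n c else 0) else 0)"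
    by (rule sum.cong) auto
  also have "\<dots> = sh_basis_mult lam m n c"
    using sh_basis_mult_eq_0[of m c n lam] by (simp add: sum.delta)
  finally show "(sh_basis m \<otimes>\<^bsub>Sh lam\<^esub> sh_basis n) c = sh_basis_mult lam m n c" .
qed

section \<open>Formal power series over this algebra\<close>

text \<open>
  Of the type \<open>fps\<close> only the coefficient sequence is used: the ring structure on the
  coefficients is that of \<open>Sh lam\<close>, not a type class instance. The coefficient of
  \<open>u\<^sup>a 1\<^sub>b\<close> in \<open>F\<close> is \<open>fps_nth F a b\<close>.
\<close>

definition sh_exp :: "real \<Rightarrow> (nat \<Rightarrow> real) \<Rightarrow> (nat \<Rightarrow> real) fps" where
  "sh_exp lam x = Abs_fps (\<lambda>n. (1 / fact n) \<odot>\<^bsub>Sh lam\<^esub> (x [^]\<^bsub>Sh lam\<^esub> n))"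

text \<open>\<open>sh_term r n k\<close> is \<open>r u\<^sup>n 1\<^sub>k\<close>.\<close>

definition sh_term :: "real \<Rightarrow> nat \<Rightarrow> nat \<Rightarrow> (nat \<Rightarrow> real) fps" where
  "sh_term r n k = Abs_fps (\<lambda>a b. if a = n \<and> b = k then r else 0)"

text \<open>
  A family has a formal sum if at each \<open>u\<^sup>a 1\<^sub>b\<close> only finitely many members contribute.
  A formal double sum is the sum of the family indexed by pairs; by
  \<open>has_formal_sum_iterated\<close> it is then also the iterated sum.
\<close>

definition has_formal_sum ::
    "('i \<Rightarrow> (nat \<Rightarrow> real) fps) \<Rightarrow> 'i set \<Rightarrow> (nat \<Rightarrow> real) fps \<Rightarrow> bool" where
  "has_formal_sum f I F \<longleftrightarrow> (\<forall>a b.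
     finite {i \<in> I. fps_nth (f i) a b \<noteq> 0} \<and>
     fps_nth F a b = (\<Sum>i | i \<in> I \<and> fps_nth (f i) a b \<noteq> 0. fps_nth (f i) a b))"

lemma has_formal_sum_unique:
  assumes "has_formal_sum f I F" "has_formal_sum f I G"
  shows "F = G"
  using assms unfolding has_formal_sum_def by (auto simp: fps_nth_inject[symmetric] fun_eq_iff)

lemma has_formal_sum_iterated:
  assumes "has_formal_sum f (Sigma I J) F"
  shows "\<exists>g. (\<forall>i\<in>I. has_formal_sum (\<lambda>j. f (i, j)) (J i) (g i)) \<and> has_formal_sum g I F"
proof -
  define N where "N a b i = {j \<in> J i. fps_nth (f (i, j)) a b \<noteq> 0}" for a b i
  define S where "S a b = {p \<in> Sigma I J. fps_nth (f p) a b \<noteq> 0}" for a b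
  define g where "g i = Abs_fps (\<lambda>a b. \<Sum>j\<in>N a b i. fps_nth (f (i, j)) a b)" for i
  have fS: "finite (S a b)" for a b
    using assms unfolding has_formal_sum_def S_def by auto
  have fN: "finite (N a b i)" if "i \<in> I" for a b i
    by (rule finite_subset[OF _ finite_imageI[OF fS[of a b], of snd]])
       (use that in \<open>force simp: N_def S_def\<close>)
  have sub: "{i \<in> I. fps_nth (g i) a b \<noteq> 0} \<subseteq> fst ` S a b" for a b
  proof
    fix i assume i: "i \<in> {i \<in> I. fps_nth (g i) a b \<noteq> 0}"
    then have "N a b i \<noteq> {}" by (auto simp: g_def)
    with i show "i \<in> fst ` S a b" by (force simp: N_def S_def)
  qed
  have "fps_nth F a b = (\<Sum>i | i \<in> I \<and> fps_nth (g i) a b \<noteq> 0. fps_nth (g i) a b)" for a b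
  proof -
    have S_Sigma: "S a b = Sigma (fst ` S a b) (N a b)"
      by (force simp: S_def N_def)
    have "fps_nth F a b = (\<Sum>p\<in>S a b. fps_nth (f p) a b)"
      using assms unfolding has_formal_sum_def S_def by auto
    also have "\<dots> = (\<Sum>p\<in>Sigma (fst ` S a b) (N a b). case p of (i, j) \<Rightarrow> fps_nth (f (i, j)) a b)"
      using S_Sigma by simp
    also have "\<dots> = (\<Sum>i\<in>fst ` S a b. \<Sum>j\<in>N a b i. fps_nth (f (i, j)) a b)"
      by (rule sum.Sigma[symmetric]) (use fS fN in \<open>auto simp: S_def\<close>)
    also have "\<dots> = (\<Sum>i\<in>fst ` S a b. fps_nth (g i) a b)"
      by (simp add: g_def)
    also have "\<dots> = (\<Sum>i | i \<in> I \<and> fps_nth (g i) a b \<noteq> 0. fps_nth (g i) a b)"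
      by (rule sum.mono_neutral_right) (use fS sub in \<open>auto simp: S_def\<close>)
    finally show ?thesis .
  qed
  moreover have "finite {i \<in> I. fps_nth (g i) a b \<noteq> 0}" for a b
    using sub fS by (meson finite_imageI finite_subset)
  ultimately have "has_formal_sum g I F"
    unfolding has_formal_sum_def by blast
  moreover have "has_formal_sum (\<lambda>j. f (i, j)) (J i) (g i)" if "i \<in> I" for i
    using fN[OF that] unfolding has_formal_sum_def g_def N_def by simp
  ultimately show ?thesis by blast
qed

section \<open>Stirling numbers of the second kind count set partitions\<close>

lemma card_partitions_insert:
  fixes A :: "'a set"
  assumes A: "finite A" and x: "x \<notin> A"
  shows "card {P. partition_on (insert x A) P \<and> card P = Suc k} =
    Suc k * card {P. partition_on A P \<and> card P = Suc k} + card {P. partition_on A P \<and> card P = k}"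
proof -
  define T where "T k = {P. partition_on A P \<and> card P = k}" for k
  define f where "f = (\<lambda>(Q, B). insert (insert x B) (Q - {B}) :: 'a set set)"
  define g where "g Q = insert {x} Q" for Q :: "'a set set"
  have fT: "finite (T k)" for k
    using finitely_many_partition_on[OF A] by (simp add: T_def)
  have fin: "finite Q" if "Q \<in> T k" for Q k
    using that finite_elements[OF A] by (auto simp: T_def)
  have noX: "x \<notin> C" if "C \<in> Q" "Q \<in> T k" for C Q k
    using that x by (auto simp: T_def partition_on_def)
  have dj: "C \<inter> D = {}" if "C \<in> Q" "D \<in> Q" "C \<noteq> D" "Q \<in> T k" for C D Q k
    using that by (auto simp: T_def partition_on_def disjoint_def)
  have inj_g: "inj_on g (T k)"
    by (rule inj_onI) (metis g_def insert_ident noX singletonI)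
  have with_x: "{C \<in> f (Q, B). x \<in> C} = {insert x B}"
    and without_x: "{C \<in> f (Q, B). x \<notin> C} = Q - {B}" if "Q \<in> T k" for Q B k
    using noX[OF _ that] by (auto simp: f_def)
  have inj_f: "inj_on f (Sigma (T (Suc k)) (\<lambda>Q. Q))"
  proof (rule inj_onI, clarify)
    fix Q B Q' B'
    assume Q: "Q \<in> T (Suc k)" "B \<in> Q" and Q': "Q' \<in> T (Suc k)" "B' \<in> Q'"
      and eq: "f (Q, B) = f (Q', B')"
    have "insert x B = insert x B'"
      using with_x[OF Q(1), of B] with_x[OF Q'(1), of B'] eq by simp
    then have B: "B = B'"
      using noX[OF Q(2,1)] noX[OF Q'(2,1)] by (simp add: insert_ident)
    have "Q - {B} = Q' - {B'}"
      using without_x[OF Q(1), of B] without_x[OF Q'(1), of B'] eq by simp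
    then show "Q = Q' \<and> B = B'" using B Q(2) Q'(2) by blast
  qed
  have "{P. partition_on (insert x A) P \<and> card P = Suc k} =
      f ` Sigma (T (Suc k)) (\<lambda>Q. Q) \<union> g ` T k" (is "?L = ?R")
  proof
    show "?R \<subseteq> ?L"
    proof
      fix P assume "P \<in> ?R"
      then consider (f) Q B where "Q \<in> T (Suc k)" "B \<in> Q" "P = insert (insert x B) (Q - {B})"
        | (g) Q where "Q \<in> T k" "P = insert {x} Q"
        by (auto simp: f_def g_def)
      then show "P \<in> ?L"
      proof cases
        case f
        have "\<Union>P = insert x A"
          using f by (auto simp: T_def partition_on_def)
        moreover have "disjoint P"
          using dj[OF _ _ _ f(1)] noX[OF _ f(1)] f(2) unfolding f(3) disjoint_def by blast
        moreover have "{} \<notin> P"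
          using f by (auto simp: T_def partition_on_def)
        moreover have "insert x B \<notin> Q - {B}" using noX[OF _ f(1)] by blast
        then have "card P = Suc k"
          using f fin[OF f(1)] by (auto simp: T_def)
        ultimately show ?thesis by (auto simp: partition_on_def)
      next
        case g
        have "{x} \<notin> Q" using noX[OF _ g(1)] by blast
        then have "card P = Suc k"
          using g fin[OF g(1)] by (auto simp: T_def)
        moreover have "disjoint P"
          using dj[OF _ _ _ g(1)] noX[OF _ g(1)] unfolding g(2) disjoint_def by blast
        ultimately show ?thesis using g by (auto simp: T_def partition_on_def)
      qed
    qed
    show "?L \<subseteq> ?R"
    proof
      fix P assume "P \<in> ?L"
      then have P: "\<Union>P = insert x A" "disjoint P" "{} \<notin> P" "card P = Suc k"
        by (auto simp: partition_on_def)
      have fP: "finite P" using P(4) card.infinite by fastforce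
      have djP: "C \<inter> D = {}" if "C \<in> P" "D \<in> P" "C \<noteq> D" for C D
        using that P(2) by (auto simp: disjoint_def)
      obtain C where C: "C \<in> P" "x \<in> C" using P(1) by blast
      have xD: "x \<notin> D" if "D \<in> P" "D \<noteq> C" for D
        using that C djP by blast
      show "P \<in> ?R"
      proof (cases "C = {x}")
        case True
        have U: "\<Union>(P - {{x}}) = A"
        proof
          show "\<Union>(P - {{x}}) \<subseteq> A"
          proof
            fix y assume "y \<in> \<Union>(P - {{x}})"
            then obtain D where "y \<in> D" "D \<in> P" "D \<noteq> C" using True by auto
            then show "y \<in> A" using xD[of D] P(1) by auto
          qed
          show "A \<subseteq> \<Union>(P - {{x}})"
          proof
            fix y assume y: "y \<in> A"
            then obtain D where "y \<in> D" "D \<in> P" using P(1) by auto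
            then show "y \<in> \<Union>(P - {{x}})" using y x by auto
          qed
        qed
        have "P - {{x}} \<in> T k"
          using P C True fP U unfolding T_def partition_on_def disjoint_def by auto
        moreover have "P = g (P - {{x}})" using C True by (auto simp: g_def)
        ultimately show ?thesis by blast
      next
        case False
        define B where "B = C - {x}"
        define Q where "Q = insert B (P - {C})"
        have B: "B \<noteq> {}" "insert x B = C" "x \<notin> B" "B \<subseteq> C" using C False by (auto simp: B_def)
        have BP: "B \<notin> P - {C}" using djP[OF C(1)] B by blast
        have "\<Union>Q = A"
        proof
          show "\<Union>Q \<subseteq> A"
          proof
            fix y assume "y \<in> \<Union>Q"
            then consider "y \<in> B" | D where "y \<in> D" "D \<in> P" "D \<noteq> C"
              by (auto simp: Q_def)
            then show "y \<in> A"
            proof cases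
              case 1
              then have "y \<in> \<Union>P" "y \<noteq> x" using C(1) by (auto simp: B_def)
              then show ?thesis using P(1) by auto
            next
              case 2
              then show ?thesis using xD[of D] P(1) by auto
            qed
          qed
          show "A \<subseteq> \<Union>Q"
          proof
            fix y assume y: "y \<in> A"
            then obtain D where "y \<in> D" "D \<in> P" using P(1) by auto
            then show "y \<in> \<Union>Q" using y x by (auto simp: Q_def B_def)
          qed
        qed
        moreover have "disjoint Q"
          using djP C(1) B(4) unfolding Q_def disjoint_def by blast
        moreover have "{} \<notin> Q" using B P by (auto simp: Q_def)
        moreover have "card Q = Suc k"
          using BP P(4) fP C by (simp add: Q_def)
        ultimately have "Q \<in> T (Suc k)" by (auto simp: T_def partition_on_def)
        moreover have "P = f (Q, B)"
          using BP B C by (auto simp: f_def Q_def)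
        moreover have "B \<in> Q" by (simp add: Q_def)
        ultimately have "P \<in> f ` Sigma (T (Suc k)) (\<lambda>Q. Q)"
          by (intro image_eqI[of _ _ "(Q, B)"] SigmaI)
        then show ?thesis ..
      qed
    qed
  qed
  moreover have "f ` Sigma (T (Suc k)) (\<lambda>Q. Q) \<inter> g ` T k = {}"
  proof -
    have "{x} \<notin> f (Q, B)" if Q: "Q \<in> T (Suc k)" "B \<in> Q" for Q B
    proof -
      have "B \<noteq> {}" using Q by (auto simp: T_def partition_on_def)
      then have "insert x B \<noteq> {x}" using noX[OF Q(2,1)] by auto
      moreover have "{x} \<notin> Q" using noX[OF _ Q(1)] by blast
      ultimately show ?thesis by (auto simp: f_def)
    qed
    then show ?thesis by (auto simp: g_def)
  qed
  moreover have "card (Sigma (T (Suc k)) (\<lambda>Q. Q)) = Suc k * card (T (Suc k))"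
  proof -
    have "card (Sigma (T (Suc k)) (\<lambda>Q. Q)) = (\<Sum>Q\<in>T (Suc k). card Q)"
      by (rule card_SigmaI) (use fT fin in auto)
    also have "\<dots> = (\<Sum>Q\<in>T (Suc k). Suc k)"
      by (rule sum.cong) (auto simp: T_def)
    finally show ?thesis by simp
  qed
  moreover have "finite (Sigma (T (Suc k)) (\<lambda>Q. Q))"
    using fT fin by blast
  ultimately show ?thesis
    using fT by (simp add: card_Un_disjoint card_image inj_f inj_g T_def[symmetric])
qed

lemma Stirling_eq_card_partitions:
  assumes "finite A"
  shows "Stirling (card A) k = card {P. partition_on A P \<and> card P = k}"
  using assms
proof (induction A arbitrary: k rule: finite_induct)
  case empty
  show ?case by (cases k) (auto simp: partition_on_empty conj_commute cong: conj_cong)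
next
  case (insert x A)
  show ?case
  proof (cases k)
    case 0
    have "\<not> (partition_on (insert x A) P \<and> card P = 0)" for P
    proof
      assume P: "partition_on (insert x A) P \<and> card P = 0"
      then have "finite P"
        using finite_elements[of "insert x A" P] insert.hyps(1) by simp
      then have "P = {}" using P by simp
      then show False using P by (auto simp: partition_on_def)
    qed
    then have "{P. partition_on (insert x A) P \<and> card P = 0} = {}" by blast
    then have "card {P. partition_on (insert x A) P \<and> card P = 0} = 0"
      by (simp only: card.empty)
    then show ?thesis by (simp only: 0 card_insert_disjoint[OF insert.hyps(1,2)] Stirling.simps)
  next
    case (Suc k')
    then show ?thesis
      using insert by (simp add: card_partitions_insert del: mult_Suc)
  qed
qed

end

theory Submission
  imports Defs
begin

text \<open>
  Multiplication by \<open>1\<^sub>1\<close> turns the coefficients \<open>a\<^sub>c\<close> into \<open>c (lam a\<^sub>c + a\<^sub>c\<^sub>-\<^sub>1)\<close>, which after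
  division by \<open>c!\<close> is the Stirling recurrence weighted by powers of \<open>lam\<close>. Both double
  sums run over the pairs \<open>k \<le> n\<close> bijectively.
\<close>

text \<open>Only \<open>i = 0\<close> and \<open>i = 1\<close> occur, with coefficients
  \<open>m + 1\<close> at index \<open>m + 1\<close> and \<open>lam * m\<close> at index
  \<open>m\<close>. Each is a multiple of its own index, so \<open>real c\<close> factors out and
  also kills the \<open>lam\<close> term when \<open>m = 0\<close>.\<close>

lemma sh_basis_mult_1_right:
  "sh_basis_mult lam m 1 c =
    real c * (lam * (if m = c then 1 else 0) + (if Suc m = c then 1 else 0))"
proof (cases m)
  case 0
  then show ?thesis by (auto simp: sh_basis_mult_def sh_basis_def)
next
  case (Suc k)
  have "{0..min m 1} = {0, 1}" using Suc by auto
  then show ?thesis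
    using Suc by (auto simp: sh_basis_mult_def sh_basis_def)
qed

text \<open>At \<open>c = 0\<close> the factor \<open>real c\<close> cancels the junk value \<open>a (0 - 1) = a 0\<close>.\<close>

lemma Sh_mult_basis_1:
  "(a \<otimes>\<^bsub>Sh lam\<^esub> sh_basis 1) c = real c * (lam * a c + a (c - 1))"
proof -
  have "(a \<otimes>\<^bsub>Sh lam\<^esub> sh_basis 1) c =
      (\<Sum>m\<le>c. \<Sum>n\<le>c. if n = 1 then a m * sh_basis_mult lam m 1 c else 0)"
    unfolding Sh_def monoid.simps by (intro sum.cong refl) (simp add: sh_basis_def)
  \<comment> \<open>For \<open>c = 0\<close> the index \<open>n = 1\<close> is out of range, but
    then \<open>sh_basis_mult lam m 1 c\<close> vanishes too.\<close>
  also have "\<dots> = (\<Sum>m\<le>c. a m * sh_basis_mult lam m 1 c)"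
    by (rule sum.cong) (use sh_basis_mult_eq_0[of _ c 1 lam] in \<open>auto simp: sum.delta\<close>)
  also have "\<dots> = (\<Sum>m\<le>c. (if m = c then real c * lam * a c else 0) +
      (if m = c - 1 then real c * a (c - 1) else 0))"
    unfolding sh_basis_mult_1_right by (rule sum.cong) auto
  also have "\<dots> = real c * (lam * a c + a (c - 1))"
    by (simp add: sum.distrib distrib_left)
  finally show ?thesis .
qed

lemma Sh_basis_1_power:
  "(sh_basis 1 [^]\<^bsub>Sh lam\<^esub> (n::nat)) k = fact k * real (Stirling n k) * lam ^ (n - k)"
proof (induction n arbitrary: k)
  case 0
  show ?case by (cases k) (auto simp: nat_pow_def Sh_def sh_basis_def)
next
  case (Suc n)
  have step: "sh_basis 1 [^]\<^bsub>Sh lam\<^esub> Suc n = (sh_basis 1 [^]\<^bsub>Sh lam\<^esub> n) \<otimes>\<^bsub>Sh lam\<^esub> sh_basis 1"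
    by (simp add: nat_pow_def)
  show ?case
  proof (cases k)
    case 0
    then show ?thesis unfolding step Sh_mult_basis_1 by simp
  next
    case (Suc j)
    show ?thesis
    proof (cases "j < n")
      case True
      then have "lam ^ (n - j) = lam * lam ^ (n - Suc j)"
        by (simp flip: power_Suc add: Suc_diff_Suc)
      then show ?thesis
        unfolding step Sh_mult_basis_1 Suc.IH by (simp add: \<open>k = Suc j\<close> algebra_simps)
    next
      \<comment> \<open>Now \<open>n \<le> j\<close>: both truncated exponents are 0, and
        \<open>Stirling n (Suc j) = 0\<close> removes the term with the extra
        \<open>lam\<close>.\<close>
      case False
      then show ?thesis
        unfolding step Sh_mult_basis_1 Suc.IH by (simp add: \<open>k = Suc j\<close>)
    qed
  qed
qed

lemma sh_exp_basis_1_nth: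
  "fps_nth (sh_exp lam (sh_basis 1)) n k =
    fact k * real (Stirling n k) * lam ^ (n - k) / fact n"
proof -
  have "fps_nth (sh_exp lam (sh_basis 1)) n k =
      1 / fact n * (sh_basis 1 [^]\<^bsub>Sh lam\<^esub> n) k"
    by (simp add: sh_exp_def) (simp add: Sh_def)
  then show ?thesis by (simp only: Sh_basis_1_power) simp
qed

text \<open>By injectivity each monomial receives at most one term, so finiteness is automatic and
  no real summation remains.\<close>

lemma has_formal_sum_sh_term:
  assumes inj: "inj_on (\<lambda>i. (p i, q i)) I"
    and coeff: "\<And>i. i \<in> I \<Longrightarrow> fps_nth F (p i) (q i) = r i"
    and zero: "\<And>a b. (a, b) \<notin> (\<lambda>i. (p i, q i)) ` I \<Longrightarrow> fps_nth F a b = 0"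
  shows "has_formal_sum (\<lambda>i. sh_term (r i) (p i) (q i)) I F"
  unfolding has_formal_sum_def
proof (intro allI)
  fix a b
  let ?S = "{i \<in> I. fps_nth (sh_term (r i) (p i) (q i)) a b \<noteq> 0}"
  have S: "?S = {i \<in> I. a = p i \<and> b = q i \<and> r i \<noteq> 0}"
    by (auto simp: sh_term_def)
  show "finite ?S \<and> fps_nth F a b = (\<Sum>i\<in>?S. fps_nth (sh_term (r i) (p i) (q i)) a b)"
  proof (cases "\<exists>i\<in>I. a = p i \<and> b = q i")
    case True
    then obtain i where i: "i \<in> I" "a = p i" "b = q i" by blast
    have "?S = (if r i = 0 then {} else {i})"
      unfolding S using i inj by (auto simp: inj_on_def)
    moreover have "fps_nth (sh_term (r i) (p i) (q i)) a b = r i" "fps_nth F a b = r i"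
      using i coeff by (simp_all add: sh_term_def)
    ultimately show ?thesis by (cases "r i = 0") (simp_all only: if_True if_False, simp_all)
  next
    case False
    then have "?S = {}" unfolding S by blast
    moreover have "fps_nth F a b = 0" using zero False by blast
    ultimately show ?thesis by (simp only: sum.empty finite.emptyI simp_thms)
  qed
qed

theorem corollary3p9:
  fixes lam :: real
  shows
    "has_formal_sum
       (\<lambda>(n, k). sh_term (fact k * real (Stirling n k) * lam ^ (n - k) / fact n) n k)
       (SIGMA n:UNIV. {0..n}) (sh_exp lam (sh_basis 1))
   \<and> has_formal_sum
       (\<lambda>(n, k). sh_term (fact n * real (Stirling (n + k) n) * lam ^ k / fact (n + k)) (n + k) n)
       (UNIV \<times> UNIV) (sh_exp lam (sh_basis 1))"
proof -
  have zero: "fps_nth (sh_exp lam (sh_basis 1)) a b = 0" if "a < b" for a b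
    using that by (simp only: sh_exp_basis_1_nth) simp
  \<comment> \<open>In the second sum \<open>n\<close> is the basis index and \<open>k\<close> the
    excess of the power of \<open>u\<close> over it.\<close>
  have mem: "(a, b) \<in> (\<lambda>(n, k). (n + k, n)) ` UNIV" if "b \<le> a" for a b :: nat
    by (rule image_eqI[of _ _ "(b, a - b)"]) (use that in auto)
  show ?thesis
    unfolding case_prod_beta
  proof (intro conjI has_formal_sum_sh_term)
    fix a b :: nat
    assume "(a, b) \<notin> (\<lambda>i. (fst i, snd i)) ` (SIGMA n:UNIV. {0..n})"
    then have "a < b" by (auto simp: image_iff)
    then show "fps_nth (sh_exp lam (sh_basis 1)) a b = 0" by (rule zero)
  next
    fix a b :: nat
    assume "(a, b) \<notin> (\<lambda>i. (fst i + snd i, fst i)) ` (UNIV \<times> UNIV)"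
    then have "a < b" using mem[of b a] by (cases "b \<le> a") (simp_all add: case_prod_beta)
    then show "fps_nth (sh_exp lam (sh_basis 1)) a b = 0" by (rule zero)
  \<comment> \<open>Injectivity and coefficients remain; keeping \<open>1\<close> unexpanded lets
    the coefficient formula match \<open>sh_basis 1\<close>.\<close>
  qed (auto simp: inj_on_def sh_exp_basis_1_nth simp del: One_nat_def)
qed

end
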